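(* Let $A_i$, $i=1,\dots,k$, be finitely generated groups with $\operatorname{asdim}A_i\le n$. Then the free product satisfies $\operatorname{asdim}\ast_{i=1}^kA_i\le 2n+1$.
   Context: Two sets $U_1,U_2$ in a metric space are $d$-disjoint if $\inf\{\operatorname{dist}(x_1,x_2)\mid x_1\in U_1,\ x_2\in U_2\}\ge d$; a family of sets is $d$-disjoint if any two distinct members are. A metric space $X$ satisfies $\operatorname{asdim}X\le n$ if for every (arbitrarily large) $d>0$ there are $n+1$ uniformly bounded $d$-disjoint families of subsets of $X$ whose union covers $X$ (uniformly bounded: diameters bounded by a common constant). A finitely generated group $\Gamma$ carries the left-invariant word metric $d_S(x,y)$ = the word length of $x^{-1}y$ with respect to a finite generating set $S$; $\operatorname{asdim}\Gamma$ means $\operatorname{asdim}(\Gamma,d_S)$, which does not depend on $S$. *)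

theory Defs
  imports "HOL-Analysis.Analysis" "HOL-Algebra.Generated_Groups"
begin

section \<open>Asymptotic dimension\<close>

context Metric_space
begin

text \<open>
  The infimum is taken in the extended reals, where the infimum over the empty set is
  infinite; in particular the empty set is \<open>r\<close>-disjoint from every set.
\<close>

definition sep_sets :: "real \<Rightarrow> 'a set \<Rightarrow> 'a set \<Rightarrow> bool" where
  "sep_sets r U V \<longleftrightarrow> (INF (x, y)\<in>U \<times> V. ereal (d x y)) \<ge> ereal r"

definition sep_family :: "real \<Rightarrow> 'a set set \<Rightarrow> bool" where
  "sep_family r \<U> \<longleftrightarrow> (\<forall>U\<in>\<U>. \<forall>V\<in>\<U>. U \<noteq> V \<longrightarrow> sep_sets r U V)"

definition uniformly_mbounded :: "'a set set \<Rightarrow> bool" where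
  "uniformly_mbounded \<U> \<longleftrightarrow> (\<exists>B::real. \<forall>U\<in>\<U>. \<forall>x\<in>U. \<forall>y\<in>U. d x y \<le> B)"

definition asdim_le :: "nat \<Rightarrow> bool" where
  "asdim_le n \<longleftrightarrow>
     (\<forall>r>0. \<exists>\<U> :: nat \<Rightarrow> 'a set set.
        (\<forall>i\<le>n. (\<forall>U\<in>\<U> i. U \<subseteq> M) \<and> uniformly_mbounded (\<U> i) \<and> sep_family r (\<U> i)) \<and>
        M \<subseteq> (\<Union>i\<le>n. \<Union>(\<U> i)))"

end

lemma (in Metric_space) sep_sets_iff: "sep_sets r U V \<longleftrightarrow> (\<forall>x\<in>U. \<forall>y\<in>V. r \<le> d x y)"
  by (auto simp: sep_sets_def le_INF_iff)


section \<open>Word metrics\<close>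

definition finite_generating_set :: "('a, 'b) monoid_scheme \<Rightarrow> 'a set \<Rightarrow> bool" where
  "finite_generating_set G S \<longleftrightarrow> finite S \<and> S \<subseteq> carrier G \<and> generate G S = carrier G"

definition finitely_generated :: "('a, 'b) monoid_scheme \<Rightarrow> bool" where
  "finitely_generated G \<longleftrightarrow> (\<exists>S. finite_generating_set G S)"

definition word_length :: "('a, 'b) monoid_scheme \<Rightarrow> 'a set \<Rightarrow> 'a \<Rightarrow> nat" where
  "word_length G S g =
     (LEAST m. \<exists>ws. set ws \<subseteq> S \<union> (\<lambda>s. inv\<^bsub>G\<^esub> s) ` S \<and> length ws = m \<and>
                   foldr (\<otimes>\<^bsub>G\<^esub>) ws \<one>\<^bsub>G\<^esub> = g)"

text \<open>
  The value outside the carrier is a convention: \<open>Metric_space\<close> asks for nonnegativity and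
  symmetry on the whole type.
\<close>

definition word_dist :: "('a, 'b) monoid_scheme \<Rightarrow> 'a set \<Rightarrow> 'a \<Rightarrow> 'a \<Rightarrow> real" where
  "word_dist G S x y =
     (if x \<in> carrier G \<and> y \<in> carrier G then real (word_length G S (inv\<^bsub>G\<^esub> x \<otimes>\<^bsub>G\<^esub> y)) else 0)"

text \<open>
  The choice of the generating set is irrelevant; see \<open>group_asdim_le_iff\<close> below.
\<close>

definition group_asdim_le :: "('a, 'b) monoid_scheme \<Rightarrow> nat \<Rightarrow> bool" where
  "group_asdim_le G n \<longleftrightarrow>
     (\<exists>S. finite_generating_set G S \<and> Metric_space.asdim_le (carrier G) (word_dist G S) n)"

context group
begin

lemma foldr_mult_closed: "set ws \<subseteq> carrier G \<Longrightarrow> foldr (\<otimes>) ws \<one> \<in> carrier G"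
  by (induction ws) auto

lemma foldr_mult_append:
  "set us \<subseteq> carrier G \<Longrightarrow> set ws \<subseteq> carrier G \<Longrightarrow>
   foldr (\<otimes>) (us @ ws) \<one> = foldr (\<otimes>) us \<one> \<otimes> foldr (\<otimes>) ws \<one>"
  by (induction us) (auto simp: m_assoc foldr_mult_closed)

lemma foldr_mult_rev_inv:
  "set ws \<subseteq> carrier G \<Longrightarrow>
   foldr (\<otimes>) (rev (map (\<lambda>s. inv s) ws)) \<one> = inv (foldr (\<otimes>) ws \<one>)"
proof (induction ws)
  case (Cons a ws)
  let ?v = "rev (map (\<lambda>s. inv s) ws)"
  have a: "a \<in> carrier G" and ws: "set ws \<subseteq> carrier G" and v: "set ?v \<subseteq> carrier G"
    using Cons.prems by auto
  have "foldr (\<otimes>) (?v @ [inv a]) \<one> = foldr (\<otimes>) ?v \<one> \<otimes> foldr (\<otimes>) [inv a] \<one>"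
    using a v by (intro foldr_mult_append) auto
  also have "\<dots> = inv (foldr (\<otimes>) ws \<one>) \<otimes> inv a"
    by (subst Cons.IH[OF ws]) (use a in simp)
  also have "\<dots> = inv (foldr (\<otimes>) (a # ws) \<one>)"
    using a foldr_mult_closed[OF ws] by (simp add: inv_mult_group)
  finally show ?case by (simp del: foldr_append)
qed simp

lemma generate_word_exists:
  assumes S: "S \<subseteq> carrier G" and g: "g \<in> generate G S"
  shows "\<exists>ws. set ws \<subseteq> S \<union> (\<lambda>s. inv s) ` S \<and> foldr (\<otimes>) ws \<one> = g"
  using g
proof (induction rule: generate.induct)
  case one
  show ?case by (rule exI[of _ "[]"]) simp
next
  case (incl h)
  then show ?case using S by (intro exI[of _ "[h]"]) auto
next
  case (inv h)
  then show ?case using S by (intro exI[of _ "[inv h]"]) auto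
next
  case (eng h1 h2)
  then obtain u v where
    "set u \<subseteq> S \<union> (\<lambda>s. inv s) ` S" "foldr (\<otimes>) u \<one> = h1"
    "set v \<subseteq> S \<union> (\<lambda>s. inv s) ` S" "foldr (\<otimes>) v \<one> = h2"
    by auto
  moreover have "S \<union> (\<lambda>s. inv s) ` S \<subseteq> carrier G" using S by auto
  ultimately show ?case
    using foldr_mult_append[of u v] by (intro exI[of _ "u @ v"]) (auto simp del: foldr_append)
qed

lemma word_length_witness:
  assumes "finite_generating_set G S" "g \<in> carrier G"
  obtains ws where "set ws \<subseteq> S \<union> (\<lambda>s. inv s) ` S" "length ws = word_length G S g"
    "foldr (\<otimes>) ws \<one> = g"
proof -
  have "\<exists>m ws. set ws \<subseteq> S \<union> (\<lambda>s. inv s) ` S \<and> length ws = m \<and> foldr (\<otimes>) ws \<one> = g"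
    using generate_word_exists[of S g] assms by (auto simp: finite_generating_set_def)
  from LeastI_ex[OF this] show ?thesis
    using that unfolding word_length_def by blast
qed

lemma word_length_le:
  assumes "set ws \<subseteq> S \<union> (\<lambda>s. inv s) ` S" "foldr (\<otimes>) ws \<one> = g"
  shows "word_length G S g \<le> length ws"
  unfolding word_length_def using assms by (intro Least_le) blast

lemma gens_subset:
  "finite_generating_set G S \<Longrightarrow> S \<union> (\<lambda>s. inv s) ` S \<subseteq> carrier G"
  by (auto simp: finite_generating_set_def)

lemma word_length_mult:
  assumes S: "finite_generating_set G S" and "g \<in> carrier G" "h \<in> carrier G"
  shows "word_length G S (g \<otimes> h) \<le> word_length G S g + word_length G S h"
proof -
  obtain u where u: "set u \<subseteq> S \<union> (\<lambda>s. inv s) ` S" "length u = word_length G S g"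
    "foldr (\<otimes>) u \<one> = g" using word_length_witness assms by blast
  obtain v where v: "set v \<subseteq> S \<union> (\<lambda>s. inv s) ` S" "length v = word_length G S h"
    "foldr (\<otimes>) v \<one> = h" using word_length_witness assms by blast
  have "set u \<subseteq> carrier G" "set v \<subseteq> carrier G"
    using u v gens_subset[OF S] by blast+
  then have "foldr (\<otimes>) (u @ v) \<one> = g \<otimes> h"
    using foldr_mult_append u v by (simp del: foldr_append)
  from word_length_le[OF _ this, of S] show ?thesis using u v by auto
qed

lemma word_length_inv_le:
  assumes S: "finite_generating_set G S" and g: "g \<in> carrier G"
  shows "word_length G S (inv g) \<le> word_length G S g"
proof -
  obtain u where u: "set u \<subseteq> S \<union> (\<lambda>s. inv s) ` S" "length u = word_length G S g"
    "foldr (\<otimes>) u \<one> = g" using word_length_witness assms by blast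
  have "set u \<subseteq> carrier G" using u gens_subset[OF S] by blast
  then have "foldr (\<otimes>) (rev (map (\<lambda>s. inv s) u)) \<one> = inv g"
    using foldr_mult_rev_inv u by simp
  moreover have "set (rev (map (\<lambda>s. inv s) u)) \<subseteq> S \<union> (\<lambda>s. inv s) ` S"
    using u S by (force simp: finite_generating_set_def)
  ultimately show ?thesis using word_length_le u by (metis length_map length_rev)
qed

lemma word_length_inv:
  assumes "finite_generating_set G S" "g \<in> carrier G"
  shows "word_length G S (inv g) = word_length G S g"
  using word_length_inv_le[OF assms] word_length_inv_le[OF assms(1) inv_closed[OF assms(2)]] assms
  by simp

lemma word_length_one [simp]: "word_length G S \<one> = 0"
  using word_length_le[of "[]" S "\<one>"] by simp

lemma word_length_eq_0:
  assumes "finite_generating_set G S" "g \<in> carrier G"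
  shows "word_length G S g = 0 \<longleftrightarrow> g = \<one>"
  using word_length_witness[OF assms] by fastforce

lemma Metric_space_word_dist:
  assumes S: "finite_generating_set G S"
  shows "Metric_space (carrier G) (word_dist G S)"
proof
  fix x y z
  show "0 \<le> word_dist G S x y" by (simp add: word_dist_def)
  show "word_dist G S x y = word_dist G S y x"
  proof (cases "x \<in> carrier G \<and> y \<in> carrier G")
    case True
    then show ?thesis
      using word_length_inv[OF S, of "inv x \<otimes> y"] by (simp add: word_dist_def inv_mult_group)
  qed (auto simp: word_dist_def)
  assume x: "x \<in> carrier G" and y: "y \<in> carrier G"
  show "word_dist G S x y = 0 \<longleftrightarrow> x = y"
    using word_length_eq_0[OF S, of "inv x \<otimes> y"] x y
    by (auto simp: word_dist_def) (metis inv_equality inv_inv inv_closed)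
  assume z: "z \<in> carrier G"
  have "(inv x \<otimes> y) \<otimes> (inv y \<otimes> z) = inv x \<otimes> z"
    using x y z by (metis inv_closed inv_solve_left m_assoc m_closed)
  then show "word_dist G S x z \<le> word_dist G S x y + word_dist G S y z"
    using word_length_mult[OF S, of "inv x \<otimes> y" "inv y \<otimes> z"] x y z
    by (simp add: word_dist_def)
qed

lemma word_length_change:
  assumes S: "finite_generating_set G S" and T: "finite_generating_set G T"
  obtains C where "C > 0" "\<And>g. g \<in> carrier G \<Longrightarrow> word_length G S g \<le> C * word_length G T g"
proof -
  let ?T = "T \<union> (\<lambda>s. inv s) ` T"
  define C where "C = Suc (\<Sum>t\<in>?T. word_length G S t)"
  have fin: "finite ?T" using T by (simp add: finite_generating_set_def)
  have C: "word_length G S t \<le> C" if "t \<in> ?T" for t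
    unfolding C_def using member_le_sum[OF that _ fin, of "word_length G S"] by simp
  have word: "word_length G S (foldr (\<otimes>) ws \<one>) \<le> C * length ws" if "set ws \<subseteq> ?T" for ws
    using that
  proof (induction ws)
    case (Cons a ws)
    then have "a \<in> carrier G" "set ws \<subseteq> carrier G" using gens_subset[OF T] by auto
    then show ?case
      using word_length_mult[OF S, of a "foldr (\<otimes>) ws \<one>"] Cons C[of a] foldr_mult_closed[of ws]
      by simp
  qed simp
  show ?thesis
  proof
    show "C > 0" by (simp add: C_def)
    fix g assume "g \<in> carrier G"
    then obtain ws where "set ws \<subseteq> ?T" "length ws = word_length G T g" "foldr (\<otimes>) ws \<one> = g"
      using word_length_witness[OF T] by blast
    then show "word_length G S g \<le> C * word_length G T g" using word by metis
  qed
qed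

lemma word_dist_change:
  assumes "finite_generating_set G S" "finite_generating_set G T"
  obtains C where "C > 0" "\<And>x y. word_dist G S x y \<le> C * word_dist G T x y"
proof -
  obtain C where "C > 0" "\<And>g. g \<in> carrier G \<Longrightarrow> word_length G S g \<le> C * word_length G T g"
    using word_length_change[OF assms] by blast
  then show ?thesis
    by (intro that[of "real C"]) (auto simp: word_dist_def simp flip: of_nat_mult)
qed

lemma asdim_le_change:
  assumes S: "finite_generating_set G S" and T: "finite_generating_set G T"
    and asdim: "Metric_space.asdim_le (carrier G) (word_dist G S) n"
  shows "Metric_space.asdim_le (carrier G) (word_dist G T) n"
proof -
  interpret MS: Metric_space "carrier G" "word_dist G S" using Metric_space_word_dist[OF S] .
  interpret MT: Metric_space "carrier G" "word_dist G T" using Metric_space_word_dist[OF T] .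
  obtain C where C: "C > 0" "\<And>x y. word_dist G S x y \<le> C * word_dist G T x y"
    using word_dist_change[OF S T] by blast
  obtain D where D: "D > 0" "\<And>x y. word_dist G T x y \<le> D * word_dist G S x y"
    using word_dist_change[OF T S] by blast
  show ?thesis
    unfolding MT.asdim_le_def
  proof (intro allI impI)
    fix r :: real assume "r > 0"
    then have "C * r > 0" using C by simp
    then obtain \<U> :: "nat \<Rightarrow> 'a set set" where
      U: "\<forall>i\<le>n. (\<forall>U\<in>\<U> i. U \<subseteq> carrier G) \<and> MS.uniformly_mbounded (\<U> i) \<and> MS.sep_family (C * r) (\<U> i)"
      and cover: "carrier G \<subseteq> (\<Union>i\<le>n. \<Union>(\<U> i))"
      using asdim[unfolded MS.asdim_le_def, rule_format, OF \<open>C * r > 0\<close>] by auto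
    have bdd: "MT.uniformly_mbounded (\<U> i)" if "i \<le> n" for i
    proof -
      obtain B where "\<forall>U\<in>\<U> i. \<forall>x\<in>U. \<forall>y\<in>U. word_dist G S x y \<le> B"
        using U \<open>i \<le> n\<close> unfolding MS.uniformly_mbounded_def by blast
      then have "\<forall>U\<in>\<U> i. \<forall>x\<in>U. \<forall>y\<in>U. word_dist G T x y \<le> D * B"
        using D by (meson mult_left_mono less_imp_le order_trans)
      then show ?thesis unfolding MT.uniformly_mbounded_def by blast
    qed
    have sep: "MT.sep_family r (\<U> i)" if "i \<le> n" for i
      unfolding MT.sep_family_def MT.sep_sets_iff
    proof (intro ballI impI)
      fix U V x y assume "U \<in> \<U> i" "V \<in> \<U> i" "U \<noteq> V" "x \<in> U" "y \<in> V"
      then have "C * r \<le> word_dist G S x y"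
        using U \<open>i \<le> n\<close> unfolding MS.sep_family_def MS.sep_sets_iff by blast
      also have "\<dots> \<le> C * word_dist G T x y" by (rule C)
      finally show "r \<le> word_dist G T x y" using C by simp
    qed
    show "\<exists>\<U> :: nat \<Rightarrow> 'a set set.
        (\<forall>i\<le>n. (\<forall>U\<in>\<U> i. U \<subseteq> carrier G) \<and> MT.uniformly_mbounded (\<U> i) \<and> MT.sep_family r (\<U> i)) \<and>
        carrier G \<subseteq> (\<Union>i\<le>n. \<Union>(\<U> i))"
    proof (intro exI conjI allI impI)
      fix i assume "i \<le> n"
      then show "\<forall>U\<in>\<U> i. U \<subseteq> carrier G" using U by blast
    qed (use bdd sep cover in auto)
  qed
qed

theorem group_asdim_le_iff:
  assumes "finite_generating_set G S"
  shows "group_asdim_le G n \<longleftrightarrow> Metric_space.asdim_le (carrier G) (word_dist G S) n"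
  unfolding group_asdim_le_def using asdim_le_change assms by blast

end


section \<open>Free products\<close>

text \<open>
  Elements are the reduced words: lists of syllables \<open>(i, a)\<close> with \<open>a\<close> a nontrivial element of
  the \<open>i\<close>-th factor, consecutive syllables belonging to different factors. The function
  \<open>syl_cons\<close> multiplies a reduced word by a syllable from the left, and the product of two
  words multiplies the second one successively by the syllables of the first.
\<close>

fun syl_cons :: "('i \<Rightarrow> ('a, 'b) monoid_scheme) \<Rightarrow> 'i \<times> 'a \<Rightarrow> ('i \<times> 'a) list \<Rightarrow> ('i \<times> 'a) list" where
  "syl_cons A (i, a) [] = (if a = \<one>\<^bsub>A i\<^esub> then [] else [(i, a)])"
| "syl_cons A (i, a) ((j, b) # w) =
     (if a = \<one>\<^bsub>A i\<^esub> then (j, b) # w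
      else if i = j then (if a \<otimes>\<^bsub>A i\<^esub> b = \<one>\<^bsub>A i\<^esub> then w else (i, a \<otimes>\<^bsub>A i\<^esub> b) # w)
      else (i, a) # (j, b) # w)"

definition reduced_words ::
    "'i set \<Rightarrow> ('i \<Rightarrow> ('a, 'b) monoid_scheme) \<Rightarrow> ('i \<times> 'a) list set" where
  "reduced_words I A =
     {w. (\<forall>(i, a)\<in>set w. i \<in> I \<and> a \<in> carrier (A i) \<and> a \<noteq> \<one>\<^bsub>A i\<^esub>) \<and>
         successively (\<lambda>p q. fst p \<noteq> fst q) w}"

definition free_product ::
    "'i set \<Rightarrow> ('i \<Rightarrow> ('a, 'b) monoid_scheme) \<Rightarrow> ('i \<times> 'a) list monoid" where
  "free_product I A = \<lparr>carrier = reduced_words I A, mult = foldr (syl_cons A), one = []\<rparr>"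

locale group_family =
  fixes I :: "'i set" and A :: "'i \<Rightarrow> ('a, 'b) monoid_scheme"
  assumes grp: "i \<in> I \<Longrightarrow> group (A i)"
begin

lemma reduced_Nil [simp]: "[] \<in> reduced_words I A"
  by (simp add: reduced_words_def)

lemma reduced_Cons:
  "(i, a) # w \<in> reduced_words I A \<longleftrightarrow>
     i \<in> I \<and> a \<in> carrier (A i) \<and> a \<noteq> \<one>\<^bsub>A i\<^esub> \<and> w \<in> reduced_words I A \<and>
     (w = [] \<or> fst (hd w) \<noteq> i)"
  by (cases w) (auto simp: reduced_words_def)

lemma syl_cons_one [simp]: "syl_cons A (i, \<one>\<^bsub>A i\<^esub>) w = w"
  by (cases w) auto

lemma syl_cons_closed:
  assumes "i \<in> I" "a \<in> carrier (A i)" "w \<in> reduced_words I A"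
  shows "syl_cons A (i, a) w \<in> reduced_words I A"
proof -
  interpret group "A i" using grp assms by blast
  show ?thesis
  proof (cases w)
    case (Cons p v)
    then show ?thesis using assms by (cases p) (auto simp: reduced_Cons)
  qed (use assms in \<open>auto simp: reduced_Cons\<close>)
qed

lemma syl_cons_mult:
  assumes "i \<in> I" "a \<in> carrier (A i)" "b \<in> carrier (A i)" "w \<in> reduced_words I A"
  shows "syl_cons A (i, a) (syl_cons A (i, b) w) = syl_cons A (i, a \<otimes>\<^bsub>A i\<^esub> b) w"
proof -
  interpret G: group "A i" using grp assms by blast
  show ?thesis
  proof (cases "w = [] \<or> fst (hd w) \<noteq> i")
    case True
    show ?thesis
    proof (cases "b = \<one>\<^bsub>A i\<^esub>")
      case False
      then have "syl_cons A (i, b) w = (i, b) # w" using True by (cases w) auto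
      moreover have "syl_cons A (i, a) ((i, b) # w) = syl_cons A (i, a \<otimes>\<^bsub>A i\<^esub> b) w"
        using True False assms by (cases w) auto
      ultimately show ?thesis by simp
    qed (use assms in auto)
  next
    case False
    then obtain c v where w: "w = (i, c) # v" by (cases w) auto
    then have c: "c \<in> carrier (A i)" "c \<noteq> \<one>\<^bsub>A i\<^esub>" and v: "v = [] \<or> fst (hd v) \<noteq> i"
      using assms by (auto simp: reduced_Cons)
    have key: "syl_cons A (i, x) ((i, y) # v) = syl_cons A (i, x \<otimes>\<^bsub>A i\<^esub> y) v"
      if "x \<in> carrier (A i)" "y \<in> carrier (A i)" "y \<noteq> \<one>\<^bsub>A i\<^esub>" for x y
      using v that by (cases v) auto
    have sc: "syl_cons A (i, x) v = (if x = \<one>\<^bsub>A i\<^esub> then v else (i, x) # v)" for x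
      using v by (cases v) auto
    have "syl_cons A (i, a) (syl_cons A (i, x) v) = syl_cons A (i, a \<otimes>\<^bsub>A i\<^esub> x) v"
      if "x \<in> carrier (A i)" for x
      using sc[of x] key[of a x] that assms by (cases "x = \<one>\<^bsub>A i\<^esub>") auto
    then show ?thesis
      using w key c assms by (simp add: G.m_assoc)
  qed
qed

lemma foldr_syl_cons_closed:
  "u \<in> reduced_words I A \<Longrightarrow> w \<in> reduced_words I A \<Longrightarrow>
   foldr (syl_cons A) u w \<in> reduced_words I A"
  by (induction u) (auto simp: reduced_Cons syl_cons_closed)

lemma foldr_syl_cons_syl_cons:
  assumes "i \<in> I" "a \<in> carrier (A i)" "v \<in> reduced_words I A" "w \<in> reduced_words I A"
  shows "foldr (syl_cons A) (syl_cons A (i, a) v) w = syl_cons A (i, a) (foldr (syl_cons A) v w)"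
proof (cases v)
  case (Cons p v')
  obtain j b where p: "p = (j, b)" by (cases p)
  interpret group "A i" using grp assms by blast
  have cl: "foldr (syl_cons A) v' w \<in> reduced_words I A"
    using assms Cons p by (intro foldr_syl_cons_closed) (auto simp: reduced_Cons)
  show ?thesis
    using assms Cons p cl syl_cons_mult[of i a b "foldr (syl_cons A) v' w"]
    by (auto simp: reduced_Cons)
qed auto

lemma foldr_syl_cons_assoc:
  assumes "u \<in> reduced_words I A" "v \<in> reduced_words I A" "w \<in> reduced_words I A"
  shows "foldr (syl_cons A) (foldr (syl_cons A) u v) w =
         foldr (syl_cons A) u (foldr (syl_cons A) v w)"
  using assms(1)
proof (induction u)
  case (Cons p u)
  obtain i a where p: "p = (i, a)" by (cases p)
  show ?case
    using Cons assms p by (simp add: reduced_Cons foldr_syl_cons_syl_cons foldr_syl_cons_closed)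
qed simp

lemma foldr_syl_cons_Nil: "u \<in> reduced_words I A \<Longrightarrow> foldr (syl_cons A) u [] = u"
proof (induction u)
  case (Cons p u)
  then show ?case by (cases p; cases u) (auto simp: reduced_Cons)
qed simp

lemma free_product_left_inverse:
  "u \<in> reduced_words I A \<Longrightarrow> \<exists>v\<in>reduced_words I A. foldr (syl_cons A) v u = []"
proof (induction u)
  case Nil
  then show ?case by (intro bexI[of _ "[]"]) auto
next
  case (Cons p u)
  obtain i a where p: "p = (i, a)" by (cases p)
  with Cons.prems have i: "i \<in> I" "a \<in> carrier (A i)" "a \<noteq> \<one>\<^bsub>A i\<^esub>" "u \<in> reduced_words I A"
    by (auto simp: reduced_Cons)
  interpret G: group "A i" using grp i by blast
  obtain v where v: "v \<in> reduced_words I A" "foldr (syl_cons A) v u = []"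
    using Cons.IH i by blast
  let ?s = "[(i, inv\<^bsub>A i\<^esub> a)]"
  have s: "?s \<in> reduced_words I A" using i by (simp add: reduced_Cons G.inv_eq_1_iff)
  have "foldr (syl_cons A) ?s (p # u) = u"
    using i p by (auto simp: G.inv_eq_1_iff)
  then have "foldr (syl_cons A) (foldr (syl_cons A) v ?s) (p # u) = []"
    using foldr_syl_cons_assoc[OF v(1) s Cons.prems] v by simp
  then show ?case using foldr_syl_cons_closed[OF v(1) s] by blast
qed

theorem group_free_product: "group (free_product I A)"
  by (rule groupI)
     (auto simp: free_product_def foldr_syl_cons_closed foldr_syl_cons_assoc
           dest: free_product_left_inverse)

end

end

theory Submission
  imports Defs
begin

text \<open>
  The Cayley graph of a free product is a tree of copies of the factors, and this makes its
  metric explicit: after cancelling the common prefix of two reduced words, the distance is the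
  sum of the lengths of what remains, except that two different first syllables from the same
  factor contribute their distance in that factor (\<open>word_dist_eq_free_dist\<close>).

  To cover the free product at scale \<open>r\<close>, slice it into annuli by \<open>q = |w| div r\<close>. Two annuli
  with different indices of the same parity are at distance at least \<open>r\<close>, so one factor of two in
  the number of colours reduces the problem to a single annulus. Inside the annulus of index
  \<open>q \<ge> 1\<close>, cut each word as \<open>w = p (i, a) v\<close> at the syllable that crosses the sphere of radius
  \<open>(q - 1) r\<close>. Words with different \<open>p\<close> or \<open>i\<close> are separated by this sphere: a path joining them has
  to descend from length at least \<open>q r\<close> to length at most \<open>(q - 1) r\<close>
  (\<open>free_dist_diff_cut\<close>). Words with the same \<open>p\<close> and \<open>i\<close> lie in a neighbourhood of bounded radius
  of the coset of the factor \<open>A i\<close> through \<open>p\<close>, because \<open>|v| \<le> 2 r\<close>. Hence the cover of \<open>A i\<close>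
  at scale \<open>r\<close> by \<open>n + 1\<close> families, pulled back along \<open>w \<mapsto> a\<close>, serves the annulus. Together with
  the parity this gives \<open>2 (n + 1)\<close> families. There are finitely many factors, so a common bound on
  the pieces exists.
\<close>

section \<open>Asymptotic dimension through colours and labels\<close>

context Metric_space
begin

text \<open>
  A cover by \<open>n + 1\<close> families is encoded by two functions: the colour of a point is a family that
  covers it, and the label is a member of that family containing it. Labels of arbitrary type make
  it possible to name the pieces instead of constructing them as sets.
\<close>

definition coarse_colouring ::
    "real \<Rightarrow> nat \<Rightarrow> ('a \<Rightarrow> nat) \<Rightarrow> ('a \<Rightarrow> 'l) \<Rightarrow> real \<Rightarrow> bool" where
  "coarse_colouring r n col lab B \<longleftrightarrow>
     (\<forall>x\<in>M. col x \<le> n \<and> (\<forall>y\<in>M. col x = col y \<longrightarrow>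
        (if lab x = lab y then d x y \<le> B else r \<le> d x y)))"

lemma asdim_le_imp_coarse_colouring:
  assumes "asdim_le n" "0 < r"
  obtains col and lab :: "'a \<Rightarrow> 'a set" and B where "coarse_colouring r n col lab B"
proof -
  obtain \<U> where U: "\<forall>c\<le>n. (\<forall>U\<in>\<U> c. U \<subseteq> M) \<and> uniformly_mbounded (\<U> c) \<and> sep_family r (\<U> c)"
    and cover: "M \<subseteq> (\<Union>c\<le>n. \<Union> (\<U> c))"
    using assms unfolding asdim_le_def by metis
  have "\<forall>c\<in>{..n}. \<exists>B. \<forall>U\<in>\<U> c. \<forall>x\<in>U. \<forall>y\<in>U. d x y \<le> B"
    using U unfolding uniformly_mbounded_def by blast
  then obtain b where b: "\<forall>c\<in>{..n}. \<forall>U\<in>\<U> c. \<forall>x\<in>U. \<forall>y\<in>U. d x y \<le> b c"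
    by (rule bchoice[THEN exE])
  define B where "B = Max (b ` {..n})"
  have bdd: "d x y \<le> B" if "c \<le> n" "U \<in> \<U> c" "x \<in> U" "y \<in> U" for c U x y
  proof -
    have "d x y \<le> b c" using b that by blast
    also have "\<dots> \<le> B" using that(1) unfolding B_def by simp
    finally show ?thesis .
  qed
  have sep: "r \<le> d x y" if "c \<le> n" "U \<in> \<U> c" "V \<in> \<U> c" "U \<noteq> V" "x \<in> U" "y \<in> V" for c U V x y
    using U that unfolding sep_family_def sep_sets_iff by blast
  have "\<forall>x\<in>M. \<exists>z. fst z \<le> n \<and> snd z \<in> \<U> (fst z) \<and> x \<in> snd z"
    using cover by fastforce
  then obtain z where z: "\<forall>x\<in>M. fst (z x) \<le> n \<and> snd (z x) \<in> \<U> (fst (z x)) \<and> x \<in> snd (z x)"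
    by (rule bchoice[THEN exE])
  have "coarse_colouring r n (\<lambda>x. fst (z x)) (\<lambda>x. snd (z x)) B"
    unfolding coarse_colouring_def
  proof (intro ballI conjI impI)
    fix x y assume xy: "x \<in> M" "y \<in> M" and col: "fst (z x) = fst (z y)"
    have zx: "fst (z x) \<le> n" "snd (z x) \<in> \<U> (fst (z x))" "x \<in> snd (z x)"
      using z xy(1) by blast+
    have zy: "snd (z y) \<in> \<U> (fst (z x))" "y \<in> snd (z y)"
      using z xy(2) unfolding col by blast+
    show "if snd (z x) = snd (z y) then d x y \<le> B else r \<le> d x y"
      using bdd[OF zx] sep[OF zx(1,2) zy(1) _ zx(3) zy(2)] zy(2) by (cases "snd (z x) = snd (z y)") auto
  qed (use z in blast)
  then show ?thesis by (rule that)
qed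

text \<open>
  The pieces are the common fibres of colour and label. Integral scales suffice, because
  separation at a larger scale is stronger.
\<close>

lemma asdim_leI_coarse_colouring:
  assumes "\<And>r::nat. 0 < r \<Longrightarrow> \<exists>col (lab :: 'a \<Rightarrow> 'l) B. coarse_colouring (real r) n col lab B"
  shows "asdim_le n"
  unfolding asdim_le_def
proof (intro allI impI)
  fix r' :: real assume "r' > 0"
  define r where "r = nat \<lceil>r'\<rceil>"
  have r: "0 < r" "r' \<le> real r" using \<open>r' > 0\<close> unfolding r_def by linarith+
  obtain col and lab :: "'a \<Rightarrow> 'l" and B where cc: "coarse_colouring (real r) n col lab B"
    using assms[OF r(1)] by blast
  define P where "P c l = {x\<in>M. col x = c \<and> lab x = l}" for c l
  show "\<exists>\<U> :: nat \<Rightarrow> 'a set set.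
        (\<forall>i\<le>n. (\<forall>U\<in>\<U> i. U \<subseteq> M) \<and> uniformly_mbounded (\<U> i) \<and> sep_family r' (\<U> i)) \<and>
        M \<subseteq> (\<Union>i\<le>n. \<Union>(\<U> i))"
  proof (intro exI[of _ "\<lambda>c. range (P c)"] conjI allI impI ballI)
    fix c U assume "U \<in> range (P c)"
    then show "U \<subseteq> M" by (auto simp: P_def)
  next
    fix c
    have "d x y \<le> B" if "x \<in> P c l" "y \<in> P c l" for x y l
      using that cc unfolding P_def coarse_colouring_def by fastforce
    then show "uniformly_mbounded (range (P c))"
      unfolding uniformly_mbounded_def by blast
    have "r' \<le> d x y" if "x \<in> P c l" "y \<in> P c l'" "l \<noteq> l'" for x y l l'
      using that cc r(2) unfolding P_def coarse_colouring_def by fastforce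
    then show "sep_family r' (range (P c))"
      unfolding sep_family_def sep_sets_iff by blast
  next
    show "M \<subseteq> (\<Union>c\<le>n. \<Union> (range (P c)))"
      using cc by (auto simp: P_def coarse_colouring_def)
  qed
qed

end

section \<open>The word metric of a free product\<close>

fun free_length :: "('i \<Rightarrow> ('a, 'b) monoid_scheme) \<Rightarrow> ('i \<Rightarrow> 'a set) \<Rightarrow> ('i \<times> 'a) list \<Rightarrow> nat" where
  "free_length A S [] = 0"
| "free_length A S ((i, a) # w) = word_length (A i) (S i) a + free_length A S w"

text \<open>
  The distance in the tree of factors, written down before it is known to be a metric: common
  syllables cancel, and at the branching point the words separate either inside one coset of a
  factor or at a vertex where cosets of different factors meet.
\<close>

fun free_dist ::
    "('i \<Rightarrow> ('a, 'b) monoid_scheme) \<Rightarrow> ('i \<Rightarrow> 'a set) \<Rightarrow> ('i \<times> 'a) list \<Rightarrow> ('i \<times> 'a) list \<Rightarrow> nat"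
where
  "free_dist A S ((i, a) # x) ((j, b) # y) =
     (if i = j then
        if a = b then free_dist A S x y
        else free_length A S x + word_length (A i) (S i) (inv\<^bsub>A i\<^esub> a \<otimes>\<^bsub>A i\<^esub> b) + free_length A S y
      else free_length A S ((i, a) # x) + free_length A S ((j, b) # y))"
| "free_dist A S x y = free_length A S x + free_length A S y"

lemma free_length_append [simp]:
  "free_length A S (u @ v) = free_length A S u + free_length A S v"
  by (induction u) auto

lemma free_dist_common_prefix: "free_dist A S (p @ x) (p @ y) = free_dist A S x y"
  by (induction p) auto

text \<open>
  The separation property of the sphere of radius \<open>t\<close>. If the two cuts differ, then the words
  branch before or inside the syllable at which one of them crosses the sphere, and the part of one
  of the words beyond the sphere, of length at least \<open>r\<close>, is contained in the path between them.
\<close>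

lemma free_dist_diff_cut:
  assumes "free_length A S p \<le> t" "t < free_length A S p + word_length (A i) (S i) a"
    and "free_length A S p' \<le> t" "t < free_length A S p' + word_length (A i') (S i') a'"
    and "t + r \<le> free_length A S (p @ (i, a) # v)"
    and "t + r \<le> free_length A S (p' @ (i', a') # v')"
    and "(p, i) \<noteq> (p', i')"
  shows "r \<le> free_dist A S (p @ (i, a) # v) (p' @ (i', a') # v')"
  using assms
proof (induction p arbitrary: p' t)
  case Nil
  then show ?case
    by (cases p') (auto split: if_splits)
next
  case (Cons s p)
  obtain j b where s: "s = (j, b)" by (cases s)
  show ?case
  proof (cases p')
    case Nil
    then show ?thesis using Cons.prems s by auto
  next
    case (Cons s' q)
    show ?thesis
    proof (cases "s' = s")
      case True
      then show ?thesis
        using Cons.prems Cons s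
          Cons.IH[of "t - word_length (A j) (S j) b" q] by auto
    next
      case False
      then show ?thesis using Cons.prems Cons s by (cases s') auto
    qed
  qed
qed

lemma free_length_cut:
  assumes "t < free_length A S w"
  obtains p i a v where "w = p @ (i, a) # v" "free_length A S p \<le> t"
    "t < free_length A S p + word_length (A i) (S i) a"
proof -
  have "\<exists>p i a v. w = p @ (i, a) # v \<and> free_length A S p \<le> t \<and>
    t < free_length A S p + word_length (A i) (S i) a"
    using assms
  proof (induction w arbitrary: t)
    case (Cons s w)
    obtain i a where s: "s = (i, a)" by (cases s)
    show ?case
    proof (cases "t < word_length (A i) (S i) a")
      case True
      then show ?thesis using s by (intro exI[of _ "[]"]) auto
    next
      case False
      then have "t - word_length (A i) (S i) a < free_length A S w"
        using Cons.prems s by simp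
      from Cons.IH[OF this] obtain p j b v where "w = p @ (j, b) # v"
        "free_length A S p \<le> t - word_length (A i) (S i) a"
        "t - word_length (A i) (S i) a < free_length A S p + word_length (A j) (S j) b"
        by blast
      with False s show ?thesis by (intro exI[of _ "(i, a) # p"]) auto
    qed
  qed simp
  then show ?thesis using that by blast
qed

locale generated_family = group_family I A
  for I :: "'i set" and A :: "'i \<Rightarrow> ('a, 'b) monoid_scheme" +
  fixes S :: "'i \<Rightarrow> 'a set"
  assumes finite_index: "finite I"
    and gens: "i \<in> I \<Longrightarrow> finite_generating_set (A i) (S i)"
begin

definition F where "F = free_product I A"

abbreviation len where "len \<equiv> free_length A S"
abbreviation wl where "wl i \<equiv> word_length (A i) (S i)"

sublocale F: group F
  unfolding F_def by (rule group_free_product)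

lemma F_simps [simp]:
  "carrier F = reduced_words I A" "x \<otimes>\<^bsub>F\<^esub> y = foldr (syl_cons A) x y" "\<one>\<^bsub>F\<^esub> = []"
  by (simp_all add: F_def free_product_def)

text \<open>
  The embedding of the factor \<open>A i\<close>; the neutral element has to go to the empty word.
\<close>

definition syl :: "'i \<Rightarrow> 'a \<Rightarrow> ('i \<times> 'a) list" where
  "syl i a = syl_cons A (i, a) []"

definition free_gens where "free_gens = (\<Union>i\<in>I. syl i ` S i)"

lemma syl_closed: "i \<in> I \<Longrightarrow> a \<in> carrier (A i) \<Longrightarrow> syl i a \<in> reduced_words I A"
  using syl_cons_closed[of i a "[]"] by (simp only: syl_def reduced_Nil)

lemma syl_mult_left:
  assumes "i \<in> I" "a \<in> carrier (A i)" "w \<in> reduced_words I A"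
  shows "foldr (syl_cons A) (syl i a) w = syl_cons A (i, a) w"
  unfolding syl_def using foldr_syl_cons_syl_cons[OF assms(1,2) reduced_Nil assms(3)] by simp

lemma syl_mult:
  assumes "i \<in> I" "a \<in> carrier (A i)" "b \<in> carrier (A i)"
  shows "syl i a \<otimes>\<^bsub>F\<^esub> syl i b = syl i (a \<otimes>\<^bsub>A i\<^esub> b)"
  using assms syl_mult_left[of i a "syl i b"] syl_closed syl_cons_mult[of i a b "[]"]
  by (simp add: syl_def)

lemma syl_inv:
  assumes "i \<in> I" "a \<in> carrier (A i)"
  shows "inv\<^bsub>F\<^esub> (syl i a) = syl i (inv\<^bsub>A i\<^esub> a)"
proof -
  interpret G: group "A i" using grp assms by blast
  have "syl i (inv\<^bsub>A i\<^esub> a) \<otimes>\<^bsub>F\<^esub> syl i a = syl i \<one>\<^bsub>A i\<^esub>"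
    using syl_mult[of i "inv\<^bsub>A i\<^esub> a" a] assms by (simp del: F_simps)
  also have "\<dots> = \<one>\<^bsub>F\<^esub>" by (simp add: syl_def)
  finally show ?thesis using F.inv_equality assms syl_closed by simp
qed

text \<open>
  This and \<open>syl_mult_eq_Cons\<close> translate between list operations on reduced words and products in
  the group, so that lengths of products can be computed by recursion on the list.
\<close>

lemma Cons_eq_syl_mult:
  assumes "(i, a) # w \<in> reduced_words I A"
  shows "(i, a) # w = syl i a \<otimes>\<^bsub>F\<^esub> w"
  using assms by (auto simp: syl_mult_left reduced_Cons) (cases w; auto)+

lemma syl_mult_eq_Cons:
  assumes "i \<in> I" "a \<in> carrier (A i)" "a \<noteq> \<one>\<^bsub>A i\<^esub>" "w \<in> reduced_words I A"
    "w = [] \<or> fst (hd w) \<noteq> i"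
  shows "syl i a \<otimes>\<^bsub>F\<^esub> w = (i, a) # w" "(i, a) # w \<in> reduced_words I A"
proof -
  show "(i, a) # w \<in> reduced_words I A" using assms by (simp add: reduced_Cons)
  then show "syl i a \<otimes>\<^bsub>F\<^esub> w = (i, a) # w"
    using Cons_eq_syl_mult by metis
qed

lemma free_gens: "finite_generating_set F free_gens"
proof -
  have sub: "free_gens \<subseteq> carrier F"
    using gens syl_closed by (fastforce simp: free_gens_def finite_generating_set_def)
  have syl: "syl i a \<in> generate F free_gens" if "i \<in> I" "a \<in> generate (A i) (S i)" for i a
    using that(2)
  proof (induction rule: generate.induct)
    case one
    then show ?case using generate.one[of F free_gens] by (simp add: syl_def)
  next
    case (incl h)
    then show ?case using that(1) by (intro generate.incl) (auto simp: free_gens_def)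
  next
    case (inv h)
    then have "h \<in> carrier (A i)" using gens[OF that(1)] by (auto simp: finite_generating_set_def)
    moreover have "inv\<^bsub>F\<^esub> (syl i h) \<in> generate F free_gens"
      using inv that(1) by (intro generate.inv) (auto simp: free_gens_def)
    ultimately show ?case using syl_inv that(1) by simp
  next
    case (eng g h)
    have "generate (A i) (S i) = carrier (A i)"
      using gens[OF that(1)] by (simp add: finite_generating_set_def)
    then show ?case
      using eng generate.eng[of "syl i g" F free_gens "syl i h"] syl_mult[OF that(1), of g h]
      by simp
  qed
  have "w \<in> generate F free_gens" if "w \<in> reduced_words I A" for w
    using that
  proof (induction w)
    case Nil
    then show ?case using generate.one[of F free_gens] by simp
  next
    case (Cons s w)
    obtain i a where s: "s = (i, a)" by (cases s)
    have "syl i a \<in> generate F free_gens" "w \<in> generate F free_gens"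
      using Cons s syl[of i a] gens[of i]
      by (auto simp: reduced_Cons finite_generating_set_def)
    then show ?case
      using generate.eng Cons_eq_syl_mult[of i a w] Cons.prems s by metis
  qed
  then have "generate F free_gens = carrier F"
    using F.generate_incl[OF sub] by auto
  then show ?thesis
    using sub finite_index gens by (auto simp: finite_generating_set_def free_gens_def)
qed

lemma len_syl_cons_le:
  assumes "i \<in> I" "a \<in> carrier (A i)" "w \<in> reduced_words I A"
  shows "len (syl_cons A (i, a) w) \<le> wl i a + len w"
proof -
  interpret G: group "A i" using grp assms by blast
  show ?thesis
  proof (cases w)
    case (Cons s v)
    obtain j b where "s = (j, b)" by (cases s)
    then show ?thesis
      using assms Cons G.word_length_mult[OF gens[OF assms(1)] assms(2), of b]
      by (auto simp: reduced_Cons)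
  qed auto
qed

lemma word_length_syl_le:
  assumes "i \<in> I" "a \<in> carrier (A i)"
  shows "word_length F free_gens (syl i a) \<le> wl i a"
proof -
  interpret G: group "A i" using grp assms by blast
  let ?T = "S i \<union> (\<lambda>s. inv\<^bsub>A i\<^esub> s) ` S i"
  obtain ws where ws: "set ws \<subseteq> ?T" "length ws = wl i a" "foldr (\<otimes>\<^bsub>A i\<^esub>) ws \<one>\<^bsub>A i\<^esub> = a"
    using G.word_length_witness[OF gens[OF assms(1)] assms(2)] by blast
  have T: "?T \<subseteq> carrier (A i)" using G.gens_subset[OF gens[OF assms(1)]] .
  have gensT: "syl i s \<in> free_gens \<union> (\<lambda>s. inv\<^bsub>F\<^esub> s) ` free_gens" if s: "s \<in> ?T" for s
  proof (cases "s \<in> S i")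
    case True
    then show ?thesis using assms by (auto simp: free_gens_def)
  next
    case False
    with s obtain t where t: "t \<in> S i" "s = inv\<^bsub>A i\<^esub> t" by blast
    then have "syl i s = inv\<^bsub>F\<^esub> (syl i t)" using syl_inv[OF assms(1), of t] T by auto
    moreover have "syl i t \<in> free_gens" using t assms by (auto simp: free_gens_def)
    ultimately show ?thesis by blast
  qed
  have "set (map (syl i) ws) \<subseteq> free_gens \<union> (\<lambda>s. inv\<^bsub>F\<^esub> s) ` free_gens"
  proof
    fix g assume "g \<in> set (map (syl i) ws)"
    then obtain s where "s \<in> set ws" "g = syl i s" by auto
    with ws(1) gensT[of s] show "g \<in> free_gens \<union> (\<lambda>s. inv\<^bsub>F\<^esub> s) ` free_gens" by blast
  qed
  moreover have "foldr (\<otimes>\<^bsub>F\<^esub>) (map (syl i) us) \<one>\<^bsub>F\<^esub> = syl i (foldr (\<otimes>\<^bsub>A i\<^esub>) us \<one>\<^bsub>A i\<^esub>)"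
    if "set us \<subseteq> ?T" for us
    using that
  proof (induction us)
    case Nil
    then show ?case by (simp add: syl_def)
  next
    case (Cons u us)
    then have "u \<in> carrier (A i)" "foldr (\<otimes>\<^bsub>A i\<^esub>) us \<one>\<^bsub>A i\<^esub> \<in> carrier (A i)"
      using T G.foldr_mult_closed[of us] by auto
    then show ?case using Cons syl_mult[OF assms(1)] by simp
  qed
  ultimately show ?thesis
    using F.word_length_le[of "map (syl i) ws" free_gens "syl i a"] ws by simp
qed

text \<open>
  The upper bound spells each syllable by a shortest word over the generators of its factor. For
  the lower bound, multiplying a reduced word by a generator from the left changes only its first
  syllable and raises the free length by at most one.
\<close>

lemma word_length_eq_len:
  assumes "w \<in> reduced_words I A"
  shows "word_length F free_gens w = len w"
proof (rule antisym)
  show "word_length F free_gens w \<le> len w"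
    using assms
  proof (induction w)
    case Nil
    then show ?case using F.word_length_one by simp
  next
    case (Cons s w)
    obtain i a where s: "s = (i, a)" by (cases s)
    have red: "i \<in> I" "a \<in> carrier (A i)" "w \<in> reduced_words I A"
      using Cons.prems s by (auto simp: reduced_Cons)
    have "word_length F free_gens (syl i a \<otimes>\<^bsub>F\<^esub> w) \<le>
        word_length F free_gens (syl i a) + word_length F free_gens w"
      using red syl_closed by (intro F.word_length_mult free_gens) auto
    also have "\<dots> \<le> wl i a + len w"
      using word_length_syl_le Cons.IH red by (simp add: add_mono)
    also have "\<dots> = len (s # w)" using s by simp
    finally show ?case
      using Cons_eq_syl_mult[of i a w] Cons.prems s by metis
  qed
next
  let ?T = "free_gens \<union> (\<lambda>s. inv\<^bsub>F\<^esub> s) ` free_gens"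
  have T: "\<exists>i\<in>I. \<exists>a\<in>carrier (A i). g = syl i a \<and> wl i a \<le> 1" if g: "g \<in> ?T" for g
  proof -
    obtain i s where i: "i \<in> I" and s: "s \<in> S i" and gs: "g = syl i s \<or> g = inv\<^bsub>F\<^esub> (syl i s)"
      using g by (auto simp: free_gens_def)
    interpret G: group "A i" using grp i by blast
    have sc: "s \<in> carrier (A i)" using gens[OF i] s by (auto simp: finite_generating_set_def)
    have "wl i s \<le> length [s]" using s sc by (intro G.word_length_le) auto
    then have "wl i s \<le> 1" by simp
    moreover have "wl i (inv\<^bsub>A i\<^esub> s) = wl i s" using G.word_length_inv[OF gens[OF i] sc] .
    ultimately show ?thesis using gs syl_inv[OF i sc] sc i by (metis G.inv_closed)
  qed
  have le: "len (foldr (\<otimes>\<^bsub>F\<^esub>) ws \<one>\<^bsub>F\<^esub>) \<le> length ws" if "set ws \<subseteq> ?T" for ws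
    using that
  proof (induction ws)
    case (Cons g ws)
    obtain i a where ia: "i \<in> I" "a \<in> carrier (A i)" "g = syl i a" "wl i a \<le> 1"
      using T[of g] Cons.prems by auto
    define w' where "w' = foldr (\<otimes>\<^bsub>F\<^esub>) ws \<one>\<^bsub>F\<^esub>"
    have "w' \<in> carrier F"
      unfolding w'_def using Cons.prems F.gens_subset[OF free_gens]
      by (intro F.foldr_mult_closed) auto
    then have w': "w' \<in> reduced_words I A" by simp
    have eq: "foldr (\<otimes>\<^bsub>F\<^esub>) (g # ws) \<one>\<^bsub>F\<^esub> = syl_cons A (i, a) w'"
      using syl_mult_left[OF ia(1,2) w'] ia(3) by (simp add: w'_def)
    have "len w' \<le> length ws" unfolding w'_def using Cons.IH Cons.prems by (simp del: F_simps)
    then show ?case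
      unfolding eq using len_syl_cons_le[OF ia(1,2) w'] ia(4) by simp
  qed simp
  obtain ws where "set ws \<subseteq> ?T" "length ws = word_length F free_gens w"
    "foldr (\<otimes>\<^bsub>F\<^esub>) ws \<one>\<^bsub>F\<^esub> = w"
    using F.word_length_witness[OF free_gens, of w] assms by auto
  then show "len w \<le> word_length F free_gens w" using le by metis
qed

lemma inv_Cons_mult:
  assumes "(i, a) # x \<in> reduced_words I A" "z \<in> reduced_words I A"
  shows "inv\<^bsub>F\<^esub> ((i, a) # x) \<otimes>\<^bsub>F\<^esub> z = inv\<^bsub>F\<^esub> x \<otimes>\<^bsub>F\<^esub> (syl i (inv\<^bsub>A i\<^esub> a) \<otimes>\<^bsub>F\<^esub> z)"
proof -
  have red: "i \<in> I" "a \<in> carrier (A i)" "x \<in> carrier F" "z \<in> carrier F"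
    using assms by (auto simp: reduced_Cons)
  interpret G: group "A i" using grp red by blast
  have s: "syl i a \<in> carrier F" "syl i (inv\<^bsub>A i\<^esub> a) \<in> carrier F"
    using red syl_closed by auto
  show ?thesis
    using red s
    by (simp add: Cons_eq_syl_mult[OF assms(1)] F.inv_mult_group syl_inv F.m_assoc del: F_simps)
qed

text \<open>
  If the two words begin in different factors, nothing cancels in \<open>x\<inverse> z\<close>. The induction moves the
  first syllable of \<open>x\<close>, inverted, to the front of \<open>z\<close>; since \<open>x\<close> is reduced, the hypothesis on the
  first syllables is preserved.
\<close>

lemma len_inv_mult_no_cancel:
  assumes "x \<in> reduced_words I A" "z \<in> reduced_words I A"
    "x = [] \<or> z = [] \<or> fst (hd x) \<noteq> fst (hd z)"
  shows "len (inv\<^bsub>F\<^esub> x \<otimes>\<^bsub>F\<^esub> z) = len x + len z"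
  using assms
proof (induction x arbitrary: z)
  case Nil
  then show ?case using F.inv_one by simp
next
  case (Cons s x)
  obtain i a where s: "s = (i, a)" by (cases s)
  have red: "i \<in> I" "a \<in> carrier (A i)" "a \<noteq> \<one>\<^bsub>A i\<^esub>" "x \<in> reduced_words I A"
    "x = [] \<or> fst (hd x) \<noteq> i"
    using Cons.prems s by (auto simp: reduced_Cons)
  interpret G: group "A i" using grp red by blast
  have "wl i (inv\<^bsub>A i\<^esub> a) = wl i a" using G.word_length_inv[OF gens] red by simp
  moreover have "syl i (inv\<^bsub>A i\<^esub> a) \<otimes>\<^bsub>F\<^esub> z = (i, inv\<^bsub>A i\<^esub> a) # z"
    "(i, inv\<^bsub>A i\<^esub> a) # z \<in> reduced_words I A"
    using syl_mult_eq_Cons[of i "inv\<^bsub>A i\<^esub> a" z] red Cons.prems s by (auto simp: G.inv_eq_1_iff)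
  ultimately show ?case
    using Cons.IH[of "(i, inv\<^bsub>A i\<^esub> a) # z"] inv_Cons_mult[of i a x z] red Cons.prems s
    by (auto simp del: F_simps)
qed

lemma len_inv_mult:
  assumes "x \<in> reduced_words I A" "y \<in> reduced_words I A"
  shows "len (inv\<^bsub>F\<^esub> x \<otimes>\<^bsub>F\<^esub> y) = free_dist A S x y"
  using assms
proof (induction x arbitrary: y)
  case Nil
  then show ?case using len_inv_mult_no_cancel[of "[]" y] by simp
next
  case (Cons s x)
  obtain i a where s: "s = (i, a)" by (cases s)
  have red: "i \<in> I" "a \<in> carrier (A i)" "a \<noteq> \<one>\<^bsub>A i\<^esub>" "x \<in> reduced_words I A"
    "x = [] \<or> fst (hd x) \<noteq> i"
    using Cons.prems s by (auto simp: reduced_Cons)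
  interpret G: group "A i" using grp red by blast
  show ?case
  proof (cases "y = [] \<or> fst (hd y) \<noteq> i")
    case True
    then show ?thesis
      using len_inv_mult_no_cancel[of "s # x" y] Cons.prems s
      by (cases y) (auto simp del: F_simps)
  next
    case False
    then obtain b z where y: "y = (i, b) # z" by (cases y) auto
    have redy: "b \<in> carrier (A i)" "b \<noteq> \<one>\<^bsub>A i\<^esub>" "z \<in> reduced_words I A"
      "z = [] \<or> fst (hd z) \<noteq> i"
      using Cons.prems y by (auto simp: reduced_Cons)
    have "inv\<^bsub>F\<^esub> (s # x) \<otimes>\<^bsub>F\<^esub> y = inv\<^bsub>F\<^esub> x \<otimes>\<^bsub>F\<^esub> (syl i (inv\<^bsub>A i\<^esub> a) \<otimes>\<^bsub>F\<^esub> (syl i b \<otimes>\<^bsub>F\<^esub> z))"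
      using inv_Cons_mult[of i a x y] Cons_eq_syl_mult[of i b z] Cons.prems s y
      by (simp del: F_simps)
    also have "syl i (inv\<^bsub>A i\<^esub> a) \<otimes>\<^bsub>F\<^esub> (syl i b \<otimes>\<^bsub>F\<^esub> z) = syl i (inv\<^bsub>A i\<^esub> a \<otimes>\<^bsub>A i\<^esub> b) \<otimes>\<^bsub>F\<^esub> z"
      using F.m_assoc[of "syl i (inv\<^bsub>A i\<^esub> a)" "syl i b" z] red redy syl_closed
      by (simp add: syl_mult[symmetric])
    finally have eq: "inv\<^bsub>F\<^esub> (s # x) \<otimes>\<^bsub>F\<^esub> y =
      inv\<^bsub>F\<^esub> x \<otimes>\<^bsub>F\<^esub> (syl i (inv\<^bsub>A i\<^esub> a \<otimes>\<^bsub>A i\<^esub> b) \<otimes>\<^bsub>F\<^esub> z)" .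
    show ?thesis
    proof (cases "a = b")
      case True
      then have "syl i (inv\<^bsub>A i\<^esub> a \<otimes>\<^bsub>A i\<^esub> b) \<otimes>\<^bsub>F\<^esub> z = z"
        using redy by (simp add: syl_def)
      then show ?thesis using eq Cons.IH[OF red(4) redy(3)] s y True by (simp del: F_simps)
    next
      case False
      let ?c = "inv\<^bsub>A i\<^esub> a \<otimes>\<^bsub>A i\<^esub> b"
      have c: "?c \<in> carrier (A i)" "?c \<noteq> \<one>\<^bsub>A i\<^esub>"
        using False red redy by (auto simp: G.inv_solve_left' G.inv_equality)
      show ?thesis
        using eq syl_mult_eq_Cons[OF red(1) c redy(3,4)]
          len_inv_mult_no_cancel[of x "(i, ?c) # z"] red s y False
        by (auto simp del: F_simps)
    qed
  qed
qed

lemma word_dist_eq_free_dist: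
  assumes "x \<in> reduced_words I A" "y \<in> reduced_words I A"
  shows "word_dist F free_gens x y = real (free_dist A S x y)"
proof -
  have "inv\<^bsub>F\<^esub> x \<otimes>\<^bsub>F\<^esub> y \<in> carrier F"
    using assms F.inv_closed F.m_closed by (simp del: F_simps(2))
  then show ?thesis
    using assms len_inv_mult word_length_eq_len by (simp add: word_dist_def del: F_simps(2))
qed

text \<open>
  The triangle inequality with the empty word as third point; the explicit distance inherits it
  from the word metric.
\<close>

lemma len_le_free_dist:
  assumes "x \<in> reduced_words I A" "y \<in> reduced_words I A"
  shows "free_dist A S x y \<le> len x + len y" "len y \<le> len x + free_dist A S x y"
    "len x \<le> len y + free_dist A S x y"
proof -
  interpret M: Metric_space "carrier F" "word_dist F free_gens"
    using F.Metric_space_word_dist[OF free_gens] .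
  have sym: "free_dist A S u v = free_dist A S v u"
    if "u \<in> reduced_words I A" "v \<in> reduced_words I A" for u v
    using M.commute[of u v] that by (simp add: word_dist_eq_free_dist)
  have tri: "free_dist A S u w \<le> free_dist A S u v + free_dist A S v w"
    if "u \<in> reduced_words I A" "v \<in> reduced_words I A" "w \<in> reduced_words I A" for u v w
    using M.triangle[of u v w] that by (simp add: word_dist_eq_free_dist)
  show "free_dist A S x y \<le> len x + len y"
    using tri[of x "[]" y] sym[of x "[]"] assms by simp
  show "len y \<le> len x + free_dist A S x y" using tri[of "[]" x y] assms by simp
  show "len x \<le> len y + free_dist A S x y" using tri[of "[]" y x] sym[of x y] assms by simp
qed

lemma reduced_suffix: "u @ s # v \<in> reduced_words I A \<Longrightarrow> v \<in> reduced_words I A"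
  by (cases v) (auto simp: reduced_words_def successively_append_iff)

section \<open>Colouring the free product\<close>

theorem asdim_free_product:
  assumes asdim: "\<And>i. i \<in> I \<Longrightarrow> Metric_space.asdim_le (carrier (A i)) (word_dist (A i) (S i)) n"
  shows "Metric_space.asdim_le (carrier F) (word_dist F free_gens) (2 * n + 1)"
proof -
  interpret M: Metric_space "carrier F" "word_dist F free_gens"
    using F.Metric_space_word_dist[OF free_gens] .
  show ?thesis
  proof (rule M.asdim_leI_coarse_colouring)
    fix r :: nat assume r: "0 < r"
    have "\<forall>i\<in>I. \<exists>z. Metric_space.coarse_colouring (carrier (A i)) (word_dist (A i) (S i))
        (real r) n (fst z) (fst (snd z) :: 'a \<Rightarrow> 'a set) (snd (snd z))"
    proof
      fix i assume i: "i \<in> I"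
      interpret G: group "A i" using grp i .
      interpret MG: Metric_space "carrier (A i)" "word_dist (A i) (S i)"
        using G.Metric_space_word_dist[OF gens[OF i]] .
      obtain col and lab :: "'a \<Rightarrow> 'a set" and B where
        "MG.coarse_colouring (real r) n col lab B"
        using MG.asdim_le_imp_coarse_colouring[OF asdim[OF i], of "real r"] r by auto
      then have "MG.coarse_colouring (real r) n (fst (col, lab, B)) (fst (snd (col, lab, B)))
          (snd (snd (col, lab, B)))"
        by simp
      then show "\<exists>z. MG.coarse_colouring (real r) n (fst z) (fst (snd z) :: 'a \<Rightarrow> 'a set) (snd (snd z))"
        by (rule exI)
    qed
    then obtain z where z: "\<forall>i\<in>I. Metric_space.coarse_colouring (carrier (A i))
        (word_dist (A i) (S i)) (real r) n (fst (z i)) (fst (snd (z i)) :: 'a \<Rightarrow> 'a set) (snd (snd (z i)))"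
      by (rule bchoice[THEN exE])
    define fcol where "fcol i = fst (z i)" for i
    define flab where "flab i = fst (snd (z i))" for i
    define B where "B i = snd (snd (z i))" for i
    have factor: "fcol i a \<le> n"
      "fcol i a = fcol i b \<Longrightarrow>
        if flab i a = flab i b then word_dist (A i) (S i) a b \<le> B i
        else real r \<le> word_dist (A i) (S i) a b"
      if "i \<in> I" "a \<in> carrier (A i)" "b \<in> carrier (A i)" for i a b
    proof -
      interpret G: group "A i" using grp that by blast
      interpret MG: Metric_space "carrier (A i)" "word_dist (A i) (S i)"
        using G.Metric_space_word_dist[OF gens[OF that(1)]] .
      have cc: "MG.coarse_colouring (real r) n (fcol i) (flab i) (B i)"
        using z that(1) unfolding fcol_def flab_def B_def by blast
      show "fcol i a \<le> n" "fcol i a = fcol i b \<Longrightarrow>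
        if flab i a = flab i b then word_dist (A i) (S i) a b \<le> B i
        else real r \<le> word_dist (A i) (S i) a b"
        using cc[unfolded MG.coarse_colouring_def] that by blast+
    qed
    \<comment> \<open>The inserted zero keeps the maximum defined for the empty family and makes the bound
      usable for the ball of short words.\<close>
    define R where "R = Max (insert 0 (B ` I))"
    have R: "0 \<le> R" "i \<in> I \<Longrightarrow> B i \<le> R" for i
      using finite_index by (auto simp: R_def)
    \<comment> \<open>The cutting radius lies \<open>r\<close> below the inner radius of the annulus of \<open>w\<close>. It is only used
      for words of length at least \<open>r\<close>, for which the subtraction is not truncated.\<close>
    define t where "t w = (len w div r - 1) * r" for w
    define cut where "cut w z \<longleftrightarrow> (\<exists>v. w = fst z @ snd z # v \<and> len (fst z) \<le> t w \<and>
        t w < len (fst z) + wl (fst (snd z)) (snd (snd z)))" for w z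
    have "\<exists>z. cut w z" if w: "r \<le> len w" for w
    proof -
      have "t w < len w div r * r"
        using r w unfolding t_def by (simp add: div_greater_zero_iff)
      then have "t w < len w" using div_times_less_eq_dividend[of "len w" r] by linarith
      from free_length_cut[OF this] obtain p i a v where
        "w = p @ (i, a) # v" "len p \<le> t w" "t w < len p + wl i a"
        by blast
      then show ?thesis unfolding cut_def by (intro exI[of _ "(p, i, a)"]) auto
    qed
    then have "\<forall>w\<in>{w. r \<le> len w}. \<exists>z. cut w z" by blast
    then obtain C where C: "\<forall>w\<in>{w. r \<le> len w}. cut w (C w)"
      by (rule bchoice[THEN exE])
    define P where "P w = fst (C w)" for w
    define J where "J w = fst (snd (C w))" for w
    define a where "a w = snd (snd (C w))" for w
    have cut: "\<exists>v. w = P w @ (J w, a w) # v" "len (P w) \<le> t w" "t w < len (P w) + wl (J w) (a w)"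
      if "r \<le> len w" for w
      using bspec[OF C, of w] that by (auto simp: cut_def P_def J_def a_def)
    have syllable: "J w \<in> I" "a w \<in> carrier (A (J w))"
      if "w \<in> reduced_words I A" "r \<le> len w" for w
    proof -
      have "(J w, a w) \<in> set w" using cut(1)[OF that(2)] by (metis in_set_conv_decomp)
      then show "J w \<in> I" "a w \<in> carrier (A (J w))" using that(1) by (auto simp: reduced_words_def)
    qed
    \<comment> \<open>The words shorter than \<open>r\<close> form the annulus of index 0, which is itself bounded and receives
      a single label; its colour 0 agrees with the parity of the index.\<close>
    define col where "col w =
        (if len w < r then 0 else 2 * fcol (J w) (a w) + (len w div r) mod 2)" for w
    define lab where "lab w =
        (len w div r, if len w < r then None else Some (P w, J w, flab (J w) (a w)))" for w
    have "M.coarse_colouring (real r) (2 * n + 1) col lab (4 * real r + R)"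
      unfolding M.coarse_colouring_def
    proof (intro ballI conjI impI)
      fix x assume "x \<in> carrier F"
      then have x: "x \<in> reduced_words I A" by simp
      show "col x \<le> 2 * n + 1"
        using factor(1) syllable[OF x] by (cases "len x < r") (fastforce simp: col_def)+
      fix y assume "y \<in> carrier F" and col: "col x = col y"
      then have y: "y \<in> reduced_words I A" by simp
      have "col w mod 2 = (len w div r) mod 2" for w by (simp add: col_def)
      with col have parity: "(len x div r) mod 2 = (len y div r) mod 2" by metis
      have bounds: "len w div r * r \<le> len w" "len w < (len w div r + 1) * r" for w
        using r by (simp_all add: div_times_less_eq_dividend dividend_less_div_times)
      have "if lab x = lab y then real (free_dist A S x y) \<le> 4 * real r + R
            else r \<le> free_dist A S x y"
      proof (cases "len x div r = len y div r")
        case False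
        have sep: "len u + r \<le> len v" if "len u div r + 2 \<le> len v div r" for u v
        proof -
          have "(len u div r + 2) * r \<le> len v" using bounds(1)[of v] that
            by (meson mult_le_mono1 order_trans)
          then show ?thesis using bounds(2)[of u] by (simp add: algebra_simps)
        qed
        have "a + 2 \<le> b \<or> b + 2 \<le> a" if "a \<noteq> b" "a mod 2 = b mod 2" for a b :: nat
        proof -
          have "b \<noteq> Suc a" "a \<noteq> Suc b" using that(2) by (auto simp: mod_Suc split: if_splits)
          then show ?thesis using that(1) by linarith
        qed
        from this[OF False parity]
        have "len x div r + 2 \<le> len y div r \<or> len y div r + 2 \<le> len x div r" .
        then have "r \<le> free_dist A S x y"
          using sep[of x y] sep[of y x] len_le_free_dist[OF x y] by linarith
        then show ?thesis using False by (simp add: lab_def)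
      next
        case same: True
        show ?thesis
        proof (cases "len x < r")
          case True
          then have "len y < r" using same r by (simp add: div_eq_0_iff)
          then show ?thesis
            using True len_le_free_dist(1)[OF x y] R(1) by (simp add: lab_def)
        next
          case False
          then have long: "r \<le> len x" "r \<le> len y"
            using same r by (auto simp: div_greater_zero_iff not_less)
              (metis div_greater_zero_iff)
          obtain v where x_eq: "x = P x @ (J x, a x) # v" using cut(1)[OF long(1)] by blast
          obtain v' where y_eq: "y = P y @ (J y, a y) # v'" using cut(1)[OF long(2)] by blast
          have q: "1 \<le> len x div r" using long(1) r by (simp add: div_greater_zero_iff Suc_le_eq)
          have ty: "t y = t x" using same by (simp add: t_def)
          have tr: "t x + r = len x div r * r" using q by (cases "len x div r") (auto simp: t_def)
          have le: "t x + r \<le> len x" "t x + r \<le> len y" using tr bounds(1) same by metis+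
          have less: "len x < t x + 2 * r" "len y < t x + 2 * r"
            using tr bounds(2)[of x] bounds(2)[of y] same by auto
          have xt: "len (P x) \<le> t x" "t x < len (P x) + wl (J x) (a x)"
            and yt: "len (P y) \<le> t x" "t x < len (P y) + wl (J y) (a y)"
            using cut(2,3)[OF long(1)] cut(2,3)[OF long(2)] ty by simp_all
          have c: "fcol (J x) (a x) = fcol (J y) (a y)"
            using col long same by (simp add: col_def)
          have lab: "lab x = lab y \<longleftrightarrow>
              (P x, J x) = (P y, J y) \<and> flab (J x) (a x) = flab (J y) (a y)"
            using long same by (auto simp: lab_def)
          show ?thesis
          proof (cases "(P x, J x) = (P y, J y)")
            case False
            have "r \<le> free_dist A S x y"
              using free_dist_diff_cut[OF xt yt, of r v v'] le False
              unfolding x_eq[symmetric] y_eq[symmetric] by blast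
            then show ?thesis using False lab by auto
          next
            case True
            let ?i = "J x"
            let ?m = "wl ?i (inv\<^bsub>A ?i\<^esub> a x \<otimes>\<^bsub>A ?i\<^esub> a y)"
            have i: "?i \<in> I" "a x \<in> carrier (A ?i)" "a y \<in> carrier (A ?i)"
              using syllable[OF x long(1)] syllable[OF y long(2)] True by auto
            have ab: "if flab ?i (a x) = flab ?i (a y) then real ?m \<le> B ?i else r \<le> ?m"
              using factor(2)[OF i] c True i by (simp add: word_dist_def split: if_splits)
            have v: "v \<in> reduced_words I A" "v' \<in> reduced_words I A"
              using reduced_suffix x y x_eq y_eq by metis+
            have "free_dist A S x y =
                free_dist A S (P x @ (J x, a x) # v) (P y @ (J y, a y) # v')"
              using x_eq y_eq by simp
            then have dist: "free_dist A S x y =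
                (if a x = a y then free_dist A S v v' else len v + ?m + len v')"
              using True by (simp add: free_dist_common_prefix)
            have "len x = len (P x) + wl (J x) (a x) + len v" "len y = len (P y) + wl (J y) (a y) + len v'"
              by (subst x_eq y_eq, simp)+
            then have "len v \<le> 2 * r" "len v' \<le> 2 * r"
              using less xt yt by linarith+
            then have "free_dist A S x y \<le> 4 * r + ?m"
              using dist len_le_free_dist(1)[OF v] by auto
            then have upper: "real (free_dist A S x y) \<le> 4 * real r + real ?m"
              by linarith
            show ?thesis
            proof (cases "flab ?i (a x) = flab ?i (a y)")
              case eq: True
              then show ?thesis using lab True upper ab R(2)[OF i(1)] by simp
            next
              case False
              then have "a x \<noteq> a y" by auto
              then show ?thesis using False ab lab dist True by simp
            qed
          qed
        qed
      qed
      then show "if lab x = lab y then word_dist F free_gens x y \<le> 4 * real r + R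
         else real r \<le> word_dist F free_gens x y"
        using word_dist_eq_free_dist[OF x y] by simp
    qed
    then show "\<exists>col (lab :: ('i \<times> 'a) list \<Rightarrow> nat \<times> (('i \<times> 'a) list \<times> 'i \<times> 'a set) option) B.
        M.coarse_colouring (real r) (2 * n + 1) col lab B"
      by blast
  qed
qed

end

theorem mainTheorem5:
  fixes A :: "nat \<Rightarrow> ('a, 'b) monoid_scheme" and k n :: nat
  assumes "\<And>i. i \<in> {1..k} \<Longrightarrow> group (A i)"
    and "\<And>i. i \<in> {1..k} \<Longrightarrow> finitely_generated (A i)"
    and "\<And>i. i \<in> {1..k} \<Longrightarrow> group_asdim_le (A i) n"
  shows "group_asdim_le (free_product {1..k} A) (2 * n + 1)"
proof -
  obtain S where S: "\<And>i. i \<in> {1..k} \<Longrightarrow> finite_generating_set (A i) (S i) \<and>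
      Metric_space.asdim_le (carrier (A i)) (word_dist (A i) (S i)) n"
    using assms(3) unfolding group_asdim_le_def by metis
  interpret generated_family "{1..k}" A S
    by (intro generated_family.intro group_family.intro generated_family_axioms.intro)
      (use assms(1) S in blast)+
  show ?thesis
    using asdim_free_product[of n] S free_gens unfolding group_asdim_le_def F_def by blast
qed

end
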